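(* Let $\underline{u}$ be the coefficient vector of the numerical solution on an element, with respect to the modal Legendre basis of polynomials of degree $\le p$ on $[-1,1]$, let $\partial_t\underline{u}$ be the time derivative given there by the semidiscretisation, let $\Delta t>0$, and let $\tilde{\underline{u}}_+=\underline{u}+\Delta t\,\partial_t\underline{u}$ have Legendre coefficients $\tilde u_{+,0},\dots,\tilde u_{+,p}$. Let $s\ge1$ be an integer and let $F$ be the modal filter of order $s$ and strength $\epsilon\geq 0$. Assume $\sum_{n=0}^p2\lambda_n^s\,\tilde u_{+,n}^2\,\|\phi_n\|^2>0$. A necessary condition on the filter strength $\epsilon$ for $$\|F\tilde{\underline{u}}_+\|_M^2=\|\underline{u}\|_M^2+2\Delta t\,\langle\underline{u},\partial_t\underline{u}\rangle_M$$ to hold is $$\epsilon\ \ge\ \Delta t\,\|\partial_t\underline{u}\|_M^2\left(\sum_{n=0}^p2\lambda_n^s\,\tilde u_{+,n}^2\,\|\phi_n\|^2\right)^{-1}.$$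
   Context: $\phi_0,\dots,\phi_p$ are the Legendre polynomials on $[-1,1]$, $\|\phi_n\|$ is the $L_2([-1,1])$ norm of $\phi_n$, and $\lambda_n=n(n+1)$. In the modal Legendre basis the mass matrix is $M=\mathrm{diag}(\|\phi_0\|^2,\dots,\|\phi_p\|^2)$; $\langle\underline{u},\underline{v}\rangle_M=\underline{u}^TM\underline{v}$ and $\|\underline{u}\|_M^2=\langle\underline{u},\underline{u}\rangle_M$. The modal filter of order $s$ and strength $\epsilon$ is $F=\mathrm{diag}\big(\exp(-\epsilon\lambda_n^s\Delta t)\big)_{n=0}^p$. The vector $\partial_t\underline{u}\in\mathbb{R}^{p+1}$ is the right-hand side of a semidiscretisation of a scalar conservation law on the element; no further property of it is used in the statement. *)

theory Defs
  imports
    "HOL-Analysis.Analysis"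
    "HOL-Computational_Algebra.Polynomial"
    "Jordan_Normal_Form.Matrix"
begin

text \<open>Rodrigues' formula; in particular the standard normalisation \<open>\<phi>\<^sub>n(1) = 1\<close>.\<close>

definition legendre :: "nat \<Rightarrow> real poly" where
  "legendre n = Polynomial.smult (1 / (2 ^ n * fact n)) ((Polynomial.pderiv ^^ n) ([:-1, 0, 1:] ^ n))"

definition legendre_norm :: "nat \<Rightarrow> real" where
  "legendre_norm n = sqrt (integral {-1..1} (\<lambda>x. (poly (legendre n) x)\<^sup>2))"

text \<open>The eigenvalue of the Legendre differential operator belonging to \<open>\<phi>\<^sub>n\<close>.\<close>

definition legendre_eig :: "nat \<Rightarrow> real" where
  "legendre_eig n = real n * (real n + 1)"

text \<open>
  Coefficient vectors with respect to \<open>\<phi>\<^sub>0, \<dots>, \<phi>\<^sub>p\<close> are elements of \<open>carrier_vec (p + 1)\<close>;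
  the entry with index \<open>n\<close> belongs to \<open>\<phi>\<^sub>n\<close>.
\<close>

definition mass_mat :: "nat \<Rightarrow> real mat" where
  "mass_mat p = mat_diag (p + 1) (\<lambda>n. (legendre_norm n)\<^sup>2)"

definition M_inner :: "nat \<Rightarrow> real Matrix.vec \<Rightarrow> real Matrix.vec \<Rightarrow> real" where
  "M_inner p u v = scalar_prod u (mass_mat p *\<^sub>v v)"

definition M_norm :: "nat \<Rightarrow> real Matrix.vec \<Rightarrow> real" where
  "M_norm p u = sqrt (M_inner p u u)"

definition modal_filter :: "nat \<Rightarrow> nat \<Rightarrow> real \<Rightarrow> real \<Rightarrow> real mat" where
  "modal_filter p s \<epsilon> \<Delta>t = mat_diag (p + 1) (\<lambda>n. exp (- \<epsilon> * legendre_eig n ^ s * \<Delta>t))"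

end

theory Submission
  imports Defs
begin

text \<open>
  Forward Euler raises the energy by exactly \<open>\<Delta>t\<^sup>2 \<parallel>\<partial>\<^sub>tu\<parallel>\<^sup>2\<close> beyond \<open>2 \<Delta>t \<langle>u, \<partial>\<^sub>tu\<rangle>\<close>, so the
  filter has to dissipate precisely this amount. By \<open>1 - exp (-x) \<le> x\<close> applied mode by mode, it
  dissipates at most its linearisation in \<open>\<epsilon>\<close>, which is \<open>\<epsilon> \<Delta>t\<close> times the sum in the statement.
\<close>

lemma mat_diag_mult_vec_index:
  assumes "v \<in> carrier_vec m" "i < m"
  shows "vec_index (mat_diag m f *\<^sub>v v) i = f i * (vec_index v i :: 'a :: semiring_1)"
proof -
  have "vec_index (mat_diag m f *\<^sub>v v) i
      = (\<Sum>j = 0..<m. (if i = j then f j else 0) * vec_index v j)"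
    using assms by (simp add: mat_diag_def scalar_prod_def)
  also have "\<dots> = (\<Sum>j = 0..<m. if i = j then f j * vec_index v j else 0)"
    by (intro sum.cong) auto
  also have "\<dots> = f i * vec_index v i"
    using assms by simp
  finally show ?thesis .
qed

lemma M_inner_eq_sum:
  assumes "v \<in> carrier_vec (p + 1)"
  shows "M_inner p u v = (\<Sum>n = 0..p. (legendre_norm n)\<^sup>2 * vec_index u n * vec_index v n)"
proof -
  \<comment> \<open>\<open>scalar_prod\<close> takes its summation range from its second argument,
    so the range is the number of rows of \<open>mass_mat p\<close>.\<close>
  have "dim_vec (mass_mat p *\<^sub>v v) = p + 1"
    by (simp add: mass_mat_def mat_diag_def)
  then have "M_inner p u v = (\<Sum>n = 0..<p + 1. vec_index u n * vec_index (mass_mat p *\<^sub>v v) n)"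
    by (simp add: M_inner_def scalar_prod_def)
  also have "\<dots> = (\<Sum>n = 0..<p + 1. (legendre_norm n)\<^sup>2 * vec_index u n * vec_index v n)"
    using assms by (intro sum.cong) (simp_all add: mass_mat_def mat_diag_mult_vec_index)
  finally show ?thesis
    by (simp add: atLeastLessThanSuc_atLeastAtMost)
qed

lemma M_norm_sq_eq_sum:
  assumes "v \<in> carrier_vec (p + 1)"
  shows "(M_norm p v)\<^sup>2 = (\<Sum>n = 0..p. (legendre_norm n)\<^sup>2 * (vec_index v n)\<^sup>2)"
proof -
  have "M_inner p v v = (\<Sum>n = 0..p. (legendre_norm n)\<^sup>2 * (vec_index v n)\<^sup>2)"
    using M_inner_eq_sum[OF assms, of v] by (simp add: power2_eq_square mult.assoc)
  \<comment> \<open>Needed to undo the \<open>sqrt\<close> in \<open>M_norm\<close>. The weights are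
    squares, so the sign is clear without evaluating any Legendre integral.\<close>
  moreover from this have "M_inner p v v \<ge> 0"
    by (simp add: sum_nonneg)
  ultimately show ?thesis
    by (simp add: M_norm_def)
qed

text \<open>Binomial expansion in each mode. With \<open>c\<close> the time step,
  \<open>u + c v\<close> is the forward Euler update, and the term quadratic in \<open>c\<close> is
  the energy surplus that the filter must remove.\<close>

lemma M_norm_sq_add_smult:
  assumes "u \<in> carrier_vec (p + 1)" "v \<in> carrier_vec (p + 1)"
  shows "(M_norm p (u + c \<cdot>\<^sub>v v))\<^sup>2
    = (M_norm p u)\<^sup>2 + 2 * c * M_inner p u v + c\<^sup>2 * (M_norm p v)\<^sup>2"
proof -
  have "(M_norm p (u + c \<cdot>\<^sub>v v))\<^sup>2
      = (\<Sum>n = 0..p. (legendre_norm n)\<^sup>2 * (vec_index u n + c * vec_index v n)\<^sup>2)"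
    using assms by (subst M_norm_sq_eq_sum) (auto intro!: sum.cong)
  also have "\<dots> = (\<Sum>n = 0..p. (legendre_norm n)\<^sup>2 * (vec_index u n)\<^sup>2
      + 2 * c * ((legendre_norm n)\<^sup>2 * vec_index u n * vec_index v n)
      + c\<^sup>2 * ((legendre_norm n)\<^sup>2 * (vec_index v n)\<^sup>2))"
    by (intro sum.cong) (simp_all add: power2_eq_square algebra_simps)
  also have "\<dots> = (M_norm p u)\<^sup>2 + 2 * c * M_inner p u v + c\<^sup>2 * (M_norm p v)\<^sup>2"
    unfolding M_norm_sq_eq_sum[OF assms(1)] M_norm_sq_eq_sum[OF assms(2)]
      M_inner_eq_sum[OF assms(2)] sum_distrib_left sum.distrib ..
  finally show ?thesis .
qed

text \<open>The filter is diagonal, so it multiplies the energy of each mode by an exponential. The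
  graph of exp lies above its tangent at 0, which gives the bound in each mode; the weights are
  nonnegative, so the bounds may be summed.\<close>

lemma M_norm_sq_modal_filter_ge:
  assumes "v \<in> carrier_vec (p + 1)"
  shows "(M_norm p (modal_filter p s \<epsilon> \<Delta>t *\<^sub>v v))\<^sup>2 \<ge> (M_norm p v)\<^sup>2
    - \<epsilon> * \<Delta>t * (\<Sum>n = 0..p. 2 * legendre_eig n ^ s * (vec_index v n)\<^sup>2 * (legendre_norm n)\<^sup>2)"
proof -
  \<comment> \<open>Decay exponent of the energy of mode n. The energy is quadratic in the
    coefficient, so the exponent is twice that of the filter; this is the 2 inside the sum of the
    statement.\<close>
  let ?x = "\<lambda>n. 2 * \<epsilon> * \<Delta>t * legendre_eig n ^ s"
  have carrier: "modal_filter p s \<epsilon> \<Delta>t *\<^sub>v v \<in> carrier_vec (p + 1)"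
    by (intro carrier_vecI) (simp add: modal_filter_def mat_diag_def)
  have "(M_norm p v)\<^sup>2
      - \<epsilon> * \<Delta>t * (\<Sum>n = 0..p. 2 * legendre_eig n ^ s * (vec_index v n)\<^sup>2 * (legendre_norm n)\<^sup>2)
      = (\<Sum>n = 0..p. (legendre_norm n)\<^sup>2 * ((1 - ?x n) * (vec_index v n)\<^sup>2))"
    unfolding M_norm_sq_eq_sum[OF assms] sum_distrib_left sum_subtractf[symmetric]
    by (intro sum.cong) (simp_all add: algebra_simps)
  also have "\<dots> \<le> (\<Sum>n = 0..p. (legendre_norm n)\<^sup>2 * (exp (- ?x n) * (vec_index v n)\<^sup>2))"
  proof (intro sum_mono mult_left_mono mult_right_mono)
    show "1 - ?x n \<le> exp (- ?x n)" for n
      using exp_ge_add_one_self[of "- ?x n"] by simp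
  qed simp_all
  also have "\<dots> = (\<Sum>n = 0..p. (legendre_norm n)\<^sup>2
      * (vec_index (modal_filter p s \<epsilon> \<Delta>t *\<^sub>v v) n)\<^sup>2)"
  proof (intro sum.cong refl arg_cong2[where f = "(*)"])
    fix n assume "n \<in> {0..p}"
    then have "vec_index (modal_filter p s \<epsilon> \<Delta>t *\<^sub>v v) n
        = exp (- \<epsilon> * legendre_eig n ^ s * \<Delta>t) * vec_index v n"
      unfolding modal_filter_def using assms by (intro mat_diag_mult_vec_index) auto
    moreover have "exp (- ?x n) = (exp (- \<epsilon> * legendre_eig n ^ s * \<Delta>t))\<^sup>2"
      unfolding exp_double[symmetric] by (simp add: mult_ac)
    ultimately show "exp (- ?x n) * (vec_index v n)\<^sup>2
        = (vec_index (modal_filter p s \<epsilon> \<Delta>t *\<^sub>v v) n)\<^sup>2"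
      by (simp only: power_mult_distrib)
  qed
  also have "\<dots> = (M_norm p (modal_filter p s \<epsilon> \<Delta>t *\<^sub>v v))\<^sup>2"
    using carrier by (rule M_norm_sq_eq_sum[symmetric])
  finally show ?thesis .
qed

theorem lemma3p4:
  fixes p s :: nat
    and u dudt u_plus :: "real Matrix.vec"
    and \<Delta>t \<epsilon> :: real
  assumes "u \<in> carrier_vec (p + 1)"
    and "dudt \<in> carrier_vec (p + 1)"
    and "\<Delta>t > 0"
    and "u_plus = u + \<Delta>t \<cdot>\<^sub>v dudt"
    and "s \<ge> 1"
    and "\<epsilon> \<ge> 0"
    and "(\<Sum>n=0..p. 2 * legendre_eig n ^ s * (vec_index u_plus n)\<^sup>2 * (legendre_norm n)\<^sup>2) > 0"
    and "(M_norm p (modal_filter p s \<epsilon> \<Delta>t *\<^sub>v u_plus))\<^sup>2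
           = (M_norm p u)\<^sup>2 + 2 * \<Delta>t * M_inner p u dudt"
  shows "\<epsilon> \<ge> \<Delta>t * (M_norm p dudt)\<^sup>2
           * inverse (\<Sum>n=0..p. 2 * legendre_eig n ^ s * (vec_index u_plus n)\<^sup>2 * (legendre_norm n)\<^sup>2)"
proof -
  let ?S = "\<Sum>n=0..p. 2 * legendre_eig n ^ s * (vec_index u_plus n)\<^sup>2 * (legendre_norm n)\<^sup>2"
  have "u_plus \<in> carrier_vec (p + 1)"
    using assms(1,2,4) by simp
  from M_norm_sq_modal_filter_ge[OF this, of \<epsilon> \<Delta>t s]
  have "(M_norm p u_plus)\<^sup>2 - \<epsilon> * \<Delta>t * ?S \<le> (M_norm p u)\<^sup>2 + 2 * \<Delta>t * M_inner p u dudt"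
    using assms(8) by simp
  moreover have "(M_norm p u_plus)\<^sup>2
      = (M_norm p u)\<^sup>2 + 2 * \<Delta>t * M_inner p u dudt + \<Delta>t\<^sup>2 * (M_norm p dudt)\<^sup>2"
    unfolding assms(4) using assms(1,2) by (rule M_norm_sq_add_smult)
  \<comment> \<open>The target energy occurs on both sides and cancels, leaving the Euler surplus
    bounded by the linearised dissipation. One factor \<Delta>t is pulled out on each side, to be
    cancelled since \<Delta>t is positive.\<close>
  ultimately have "\<Delta>t * (\<Delta>t * (M_norm p dudt)\<^sup>2) \<le> \<Delta>t * (\<epsilon> * ?S)"
    by (simp add: power2_eq_square algebra_simps)
  then have "\<Delta>t * (M_norm p dudt)\<^sup>2 \<le> \<epsilon> * ?S"
    using assms(3) by (rule mult_left_le_imp_le)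
  then show ?thesis
    using assms(7) by (simp only: pos_divide_le_eq flip: divide_inverse)
qed

end
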